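(* Let $X$ be a Banach space and $k\in\mathbb{N}$. If $\mathcal{SM}^{wrc}_k(X)$ contains a sequence equivalent to the usual basis of $c_0$, then the dual $X^*$ admits a $k$-spreading model equivalent to the usual basis of $\ell^1$, i.e. there is a $k$-sequence in $X^*$ generating a $k$-spreading model equivalent to the usual basis of $\ell^1$.
   Context: $[M]^k$: $k$-subsets of $M\subseteq\mathbb{N}$ (increasing enumerations, $M(l)$ the $l$-th element). A $k$-sequence in a Banach space $Y$ is a map $[\mathbb{N}]^k\to Y$. Plegma family: $(s_j)_{j=1}^l$ in $[M]^k$ with $s_1(i)<\dots<s_l(i)$ ($i\le k$), $s_l(i)<s_1(i+1)$ ($i<k$). $(x_s)_{s\in[M]^k}$ generates the Hamel basis $(e_n)$ of a seminormed space $(E,\|\cdot\|_* )$ as a $k$-spreading model if for a null sequence $\delta_l>0$: $|\|\sum_{j=1}^m a_jx_{s_j}\|-\|\sum_{j=1}^m a_je_j\|_*|\le\delta_l$ for all $m\le l$, plegma $(s_j)_{j=1}^m$ in $[M]^k$ with $s_1(1)\ge M(l)$, $a_j\in[-1,1]$. A $k$-sequence is weakly relatively compact if the weak closure of its set of values is weakly compact; $\mathcal{SM}^{wrc}_k(X)$ is the set of sequences generated as $k$-spreading models by weakly relatively compact $k$-sequences in $X$. *)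

theory Defs
  imports "HOL-Analysis.Analysis" "HOL-Analysis.Finite_Function_Topology"
begin

(* k-subsets of M are represented by strictly increasing lists of length k with
   entries in M; s ! i is the (i+1)-th element s(i+1). *)
definition ksubsets :: "nat set \<Rightarrow> nat \<Rightarrow> nat list set" where
  "ksubsets M k = {s. sorted_wrt (<) s \<and> length s = k \<and> set s \<subseteq> M}"

definition plegma :: "nat \<Rightarrow> nat list list \<Rightarrow> bool" where
  "plegma k ss \<longleftrightarrow>
     (\<forall>j. Suc j < length ss \<longrightarrow> (\<forall>i<k. ss ! j ! i < ss ! Suc j ! i)) \<and>
     (ss \<noteq> [] \<longrightarrow> (\<forall>i. Suc i < k \<longrightarrow> last ss ! i < hd ss ! Suc i))"

definition seminorm :: "('e::real_vector \<Rightarrow> real) \<Rightarrow> bool" where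
  "seminorm nrm \<longleftrightarrow> (\<forall>x. 0 \<le> nrm x) \<and> (\<forall>c x. nrm (c *\<^sub>R x) = \<bar>c\<bar> * nrm x)
     \<and> (\<forall>x y. nrm (x + y) \<le> nrm x + nrm y)"

definition hamel_basis :: "(nat \<Rightarrow> 'e::real_vector) \<Rightarrow> bool" where
  "hamel_basis e \<longleftrightarrow> inj e \<and> independent (range e) \<and> span (range e) = UNIV"

(* x generates (e_n) of (E, nrm) as a k-spreading model.
   Indexing: delta_l for l >= 1, M(l) = enumerate M (l - 1), e_j for j = 1..m is e (j-1). *)
definition generates_ksm ::
  "nat \<Rightarrow> (nat list \<Rightarrow> 'a::real_normed_vector) \<Rightarrow> (nat \<Rightarrow> 'e::real_vector) \<Rightarrow> ('e \<Rightarrow> real) \<Rightarrow> bool" where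
  "generates_ksm k x e nrm \<longleftrightarrow>
     (\<exists>M \<delta>. M \<subseteq> UNIV \<and> infinite M \<and> (\<forall>l. 0 < \<delta> l) \<and> \<delta> \<longlonglongrightarrow> 0 \<and>
       (\<forall>l\<ge>1. \<forall>m\<le>l. \<forall>ss a.
          length ss = m \<and> set ss \<subseteq> ksubsets M k \<and> plegma k ss \<and>
          (ss \<noteq> [] \<longrightarrow> hd ss ! 0 \<ge> enumerate M (l - 1)) \<and>
          (\<forall>j<m. \<bar>a j\<bar> \<le> 1) \<longrightarrow>
          \<bar>norm (\<Sum>j<m. a j *\<^sub>R x (ss ! j)) - nrm (\<Sum>j<m. a j *\<^sub>R e j)\<bar> \<le> \<delta> l))"

definition weak_topology :: "'a::real_normed_vector topology" where
  "weak_topology = topology_generated_by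
     {f -` U | (f :: 'a \<Rightarrow> real) U. bounded_linear f \<and> open U}"

definition weakly_rel_compact_kseq :: "nat \<Rightarrow> (nat list \<Rightarrow> 'a::real_normed_vector) \<Rightarrow> bool" where
  "weakly_rel_compact_kseq k x \<longleftrightarrow>
     compactin weak_topology (weak_topology closure_of (x ` ksubsets UNIV k))"

definition equiv_c0_basis :: "(nat \<Rightarrow> 'e::real_vector) \<Rightarrow> ('e \<Rightarrow> real) \<Rightarrow> bool" where
  "equiv_c0_basis e nrm \<longleftrightarrow> (\<exists>c C. 0 < c \<and> 0 < C \<and> (\<forall>m a. m \<ge> 1 \<longrightarrow>
     c * Max ((\<lambda>j. \<bar>a j\<bar>) ` {..<m}) \<le> nrm (\<Sum>j<m. a j *\<^sub>R e j) \<and>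
     nrm (\<Sum>j<m. a j *\<^sub>R e j) \<le> C * Max ((\<lambda>j. \<bar>a j\<bar>) ` {..<m})))"

definition equiv_l1_basis :: "(nat \<Rightarrow> 'e::real_vector) \<Rightarrow> ('e \<Rightarrow> real) \<Rightarrow> bool" where
  "equiv_l1_basis e nrm \<longleftrightarrow> (\<exists>c C. 0 < c \<and> 0 < C \<and> (\<forall>m (a :: nat \<Rightarrow> real).
     c * (\<Sum>j<m. \<bar>a j\<bar>) \<le> nrm (\<Sum>j<m. a j *\<^sub>R e j) \<and>
     nrm (\<Sum>j<m. a j *\<^sub>R e j) \<le> C * (\<Sum>j<m. \<bar>a j\<bar>)))"

end

theory Submission
  imports Defs "HOL-Library.Ramsey" "HOL-Library.Diagonal_Subsequence"
begin

text \<open>The spreading-model hypothesis controls a family of m sets only when m <= l and the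
  family begins at or beyond \<open>M(l)\<close>: longer families must begin later. Every
  requirement is therefore attached to a tail. A set is sought whose tail from index l has error
  1/(l+1), for families of at most l+1 members as well as for pairs, and lies beyond the threshold
  that belongs to l. All these properties pass to subsets, which is what a diagonal set needs.
  Smallness on pairs is useful because m is fixed in the l^1 estimate while the family may be taken
  arbitrarily late: the off-diagonal loss is at most m times a null sequence and disappears from the
  limit seminorm. What remains is the constant c/K, where c bounds \<open>norm (x s)\<close> from
  below and K bounds the signed sums of the vectors from above. The upper l^1 constant is 1, because
  norming functionals can be taken in the unit ball.\<close>

text \<open>
  Take \<open>y s\<close> to be a norming functional of \<open>x s\<close>. In a plegma family \<open>s\<^sub>1, \<dots>, s\<^sub>l\<close> that starts
  late, the upper \<open>c\<^sub>0\<close>-estimate bounds \<open>\<Sum>j. \<bar>y s (x s\<^sub>j)\<bar>\<close> independently of \<open>l\<close>, so by Ramsey's theorem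
  both \<open>y s (x t)\<close> and \<open>y t (x s)\<close> become arbitrarily small on plegma pairs of a suitable infinite
  set. Testing \<open>\<Sum>j. a\<^sub>j y s\<^sub>j\<close> on \<open>\<Sum>j. sgn a\<^sub>j x s\<^sub>j\<close> then yields the lower \<open>\<ell>\<^sup>1\<close>-estimate, and a
  further application of Ramsey's theorem with a diagonal argument makes \<open>y\<close> generate a spreading
  model.
\<close>

subsection \<open>The Hahn--Banach theorem\<close>

definition sublinear :: "('a::real_vector \<Rightarrow> real) \<Rightarrow> bool" where
  "sublinear q \<longleftrightarrow> (\<forall>x y. q (x + y) \<le> q x + q y) \<and> (\<forall>t x. 0 \<le> t \<longrightarrow> q (t *\<^sub>R x) = t * q x)"

lemma sublinear_zero: "sublinear q \<Longrightarrow> q 0 = 0"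
  unfolding sublinear_def by (metis mult_zero_left order_refl scaleR_zero_left)

lemma sublinear_ge_uminus:
  assumes "sublinear q"
  shows "- q (- x) \<le> q x"
proof -
  have "q (x + - x) \<le> q x + q (- x)"
    using assms unfolding sublinear_def by blast
  then show ?thesis
    using sublinear_zero[OF assms] by simp
qed

text \<open>A sublinear minorant of \<open>q\<close> with value at most \<open>- q z\<close> at \<open>- z\<close>. A minimal sublinear \<open>q\<close> equals
  all of these, hence is odd, hence linear.\<close>

definition slope_minorant :: "('a::real_vector \<Rightarrow> real) \<Rightarrow> 'a \<Rightarrow> 'a \<Rightarrow> real" where
  "slope_minorant q z y = (INF t\<in>{0..}. q (y + t *\<^sub>R z) - t * q z)"

lemma slope_minorant_le:
  assumes "sublinear q" "0 \<le> t"
  shows "slope_minorant q z y \<le> q (y + t *\<^sub>R z) - t * q z"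
  unfolding slope_minorant_def
proof (rule cINF_lower)
  show "bdd_below ((\<lambda>t. q (y + t *\<^sub>R z) - t * q z) ` {0..})"
  proof (rule bdd_belowI2)
    fix t :: real assume "t \<in> {0..}"
    then have "t * q z = q ((y + t *\<^sub>R z) + - y)"
      using assms(1) by (simp add: sublinear_def)
    also have "\<dots> \<le> q (y + t *\<^sub>R z) + q (- y)"
      using assms(1) unfolding sublinear_def by blast
    finally show "- q (- y) \<le> q (y + t *\<^sub>R z) - t * q z" by simp
  qed
qed (use assms in auto)

lemma slope_minorant_below: "sublinear q \<Longrightarrow> slope_minorant q z y \<le> q y"
  using slope_minorant_le[of q 0 z y] by simp

lemma slope_minorant_uminus: "sublinear q \<Longrightarrow> slope_minorant q z (- z) \<le> - q z"
  using slope_minorant_le[of q 1 z "- z"] by (simp add: sublinear_zero)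

text \<open>Steps s at x and t at y combine to the step s + t at x + y, and a step t at y scales to
  the step d t at d y; taking infima over the steps gives both properties.\<close>

lemma sublinear_slope_minorant:
  assumes q: "sublinear q"
  shows "sublinear (slope_minorant q z)"
  unfolding sublinear_def
proof (intro conjI allI impI)
  fix x y
  have *: "slope_minorant q z (x + y) - (q (x + s *\<^sub>R z) - s * q z) \<le> q (y + t *\<^sub>R z) - t * q z"
    if "0 \<le> s" "0 \<le> t" for s t
  proof -
    have "slope_minorant q z (x + y) \<le> q ((x + y) + (s + t) *\<^sub>R z) - (s + t) * q z"
      using that by (intro slope_minorant_le[OF q]) auto
    also have "(x + y) + (s + t) *\<^sub>R z = (x + s *\<^sub>R z) + (y + t *\<^sub>R z)"
      by (simp add: algebra_simps)
    also have "q \<dots> \<le> q (x + s *\<^sub>R z) + q (y + t *\<^sub>R z)"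
      using q unfolding sublinear_def by blast
    finally show ?thesis by (simp add: algebra_simps)
  qed
  have "slope_minorant q z (x + y) - slope_minorant q z y \<le> q (x + s *\<^sub>R z) - s * q z"
    if "0 \<le> s" for s
  proof -
    have "slope_minorant q z (x + y) - (q (x + s *\<^sub>R z) - s * q z) \<le> slope_minorant q z y"
      unfolding slope_minorant_def[of q z y] by (rule cINF_greatest) (use * that in auto)
    then show ?thesis by simp
  qed
  then have "slope_minorant q z (x + y) - slope_minorant q z y \<le> slope_minorant q z x"
    unfolding slope_minorant_def[of q z x] by (intro cINF_greatest) auto
  then show "slope_minorant q z (x + y) \<le> slope_minorant q z x + slope_minorant q z y" by simp
next
  fix c :: real and x assume "0 \<le> c"
  show "slope_minorant q z (c *\<^sub>R x) = c * slope_minorant q z x"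
  proof (cases "c = 0")
    case True
    have "0 \<le> q (0 + t *\<^sub>R z) - t * q z" if "0 \<le> t" for t
      using q that by (simp add: sublinear_def)
    then have "0 \<le> slope_minorant q z 0"
      unfolding slope_minorant_def by (intro cINF_greatest) auto
    with slope_minorant_below[OF q, of z 0] sublinear_zero[OF q] True show ?thesis by simp
  next
    case False
    \<comment> \<open>One inequality for all positive factors suffices: applied to c and to 1/c it
      gives the two halves of the equality.\<close>
    have scale: "d * slope_minorant q z y \<ge> slope_minorant q z (d *\<^sub>R y)" if "0 < d" for d y
    proof -
      have "slope_minorant q z (d *\<^sub>R y) / d \<le> q (y + t *\<^sub>R z) - t * q z" if "0 \<le> t" for t
      proof -
        have "slope_minorant q z (d *\<^sub>R y) \<le> q (d *\<^sub>R y + (d * t) *\<^sub>R z) - (d * t) * q z"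
          using that \<open>0 < d\<close> by (intro slope_minorant_le[OF q]) auto
        also have "d *\<^sub>R y + (d * t) *\<^sub>R z = d *\<^sub>R (y + t *\<^sub>R z)"
          by (simp add: algebra_simps)
        also have "q \<dots> = d * q (y + t *\<^sub>R z)"
          using q \<open>0 < d\<close> by (simp add: sublinear_def)
        finally show ?thesis using \<open>0 < d\<close> by (simp add: field_simps)
      qed
      then have "slope_minorant q z (d *\<^sub>R y) / d \<le> slope_minorant q z y"
        unfolding slope_minorant_def[of q z y] by (intro cINF_greatest) auto
      then show ?thesis using \<open>0 < d\<close> by (simp add: field_simps)
    qed
    from False \<open>0 \<le> c\<close> have "0 < c" by simp
    have "c * slope_minorant q z ((1 / c) *\<^sub>R (c *\<^sub>R x)) \<le> c * ((1 / c) * slope_minorant q z (c *\<^sub>R x))"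
      using scale[of "1 / c" "c *\<^sub>R x"] \<open>0 < c\<close> by (intro mult_left_mono) auto
    with scale[of c x] \<open>0 < c\<close> show ?thesis by simp
  qed
qed

text \<open>Zorn's lemma for the reversed pointwise order. The pointwise infimum of a chain is
  finite because q <= p forces q x >= - p (- x), and it is subadditive because any two members of a
  chain can be replaced by the smaller one.\<close>

lemma minimal_sublinear_exists:
  assumes p: "sublinear p"
  obtains q where "sublinear q" "q \<le> p" "\<And>r. sublinear r \<Longrightarrow> r \<le> q \<Longrightarrow> r = q"
proof -
  define A where "A = {q. sublinear q \<and> q \<le> p}"
  have "\<exists>m\<in>A. \<forall>a\<in>A. m \<ge> a \<longrightarrow> a = m"
  proof (rule predicate_Zorn)
    show "partial_order_on A (relation_of (\<ge>) A)"
      by (rule partial_order_on_relation_ofI) auto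
    fix C assume C: "C \<in> Chains (relation_of (\<ge>) A)"
    then have CA: "C \<subseteq> A"
      by (auto simp: Chains_def relation_of_def)
    have tot: "a \<le> b \<or> b \<le> a" if "a \<in> C" "b \<in> C" for a b
      using C that by (auto simp: Chains_def relation_of_def)
    show "\<exists>u\<in>A. \<forall>a\<in>C. u \<le> a"
    proof (cases "C = {}")
      case True
      then show ?thesis using p by (auto simp: A_def)
    next
      case False
      define u where "u x = (INF q\<in>C. q x)" for x
      have bdd: "bdd_below ((\<lambda>q. q x) ` C)" for x
      proof (rule bdd_belowI2)
        fix q assume "q \<in> C"
        then have "sublinear q" "q (- x) \<le> p (- x)"
          using CA by (auto simp: A_def le_fun_def)
        then show "- p (- x) \<le> q x"
          using sublinear_ge_uminus[of q x] by linarith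
      qed
      have u_le: "u x \<le> q x" if "q \<in> C" for q x
        unfolding u_def by (rule cINF_lower[OF bdd that])
      have u_ge: "b \<le> u x" if "\<And>q. q \<in> C \<Longrightarrow> b \<le> q x" for b x
        unfolding u_def by (rule cINF_greatest[OF False that])
      have "sublinear u"
        unfolding sublinear_def
      proof (intro conjI allI impI)
        fix x y
        have *: "u (x + y) - q x \<le> r y" if qr: "q \<in> C" "r \<in> C" for q r
        proof -
          obtain s where s: "s \<in> C" "s \<le> q" "s \<le> r"
            using tot[OF qr] qr by auto
          have "u (x + y) \<le> s (x + y)" by (rule u_le[OF s(1)])
          also have "\<dots> \<le> s x + s y"
            using s CA by (auto simp: A_def sublinear_def)
          also have "\<dots> \<le> q x + r y"
            using s by (auto simp: le_fun_def intro: add_mono)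
          finally show ?thesis by simp
        qed
        have "u (x + y) - u y \<le> q x" if "q \<in> C" for q
          using u_ge[of "u (x + y) - q x" y] *[OF that] by simp
        then have "u (x + y) - u y \<le> u x" by (rule u_ge)
        then show "u (x + y) \<le> u x + u y" by simp
      next
        fix t :: real and x assume "0 \<le> t"
        have hom: "q (t *\<^sub>R x) = t * q x" if "q \<in> C" for q
          using that CA \<open>0 \<le> t\<close> by (auto simp: A_def sublinear_def)
        show "u (t *\<^sub>R x) = t * u x"
        proof (cases "t = 0")
          case True
          have "u (t *\<^sub>R x) = (INF q\<in>C. 0)"
            unfolding u_def by (intro arg_cong[where f = Inf] image_cong refl) (use hom True in fastforce)
          also have "\<dots> = 0" using False by simp
          finally show ?thesis using True by simp
        next
          case nz: False
          then have "0 < t" using \<open>0 \<le> t\<close> by simp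
          have "u (t *\<^sub>R x) / t \<le> u x"
          proof (rule u_ge)
            fix q assume "q \<in> C"
            then show "u (t *\<^sub>R x) / t \<le> q x"
              using u_le[of q "t *\<^sub>R x"] hom[of q] \<open>0 < t\<close> by (simp add: divide_le_eq mult.commute)
          qed
          moreover have "t * u x \<le> u (t *\<^sub>R x)"
          proof (rule u_ge)
            fix q assume "q \<in> C"
            then show "t * u x \<le> q (t *\<^sub>R x)"
              using u_le[of q x] hom[of q] \<open>0 < t\<close> by simp
          qed
          ultimately show ?thesis using \<open>0 < t\<close> by (simp add: field_simps)
        qed
      qed
      moreover have "u \<le> p"
      proof (rule le_funI)
        fix x
        obtain q where q: "q \<in> C" using False by blast
        then have "q \<le> p" using CA unfolding A_def by blast
        with u_le[OF q, of x] show "u x \<le> p x" by (metis le_funD order_trans)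
      qed
      ultimately have "u \<in> A" by (simp add: A_def)
      moreover have "\<forall>a\<in>C. u \<le> a" using u_le by (intro ballI le_funI)
      ultimately show ?thesis by blast
    qed
  qed
  then obtain q where "q \<in> A" and min: "\<And>a. a \<in> A \<Longrightarrow> a \<le> q \<Longrightarrow> a = q" by blast
  show thesis
  proof (rule that)
    fix r assume "sublinear r" "r \<le> q"
    then show "r = q"
      using \<open>q \<in> A\<close> by (intro min) (auto simp: A_def)
  qed (use \<open>q \<in> A\<close> in \<open>auto simp: A_def\<close>)
qed

theorem Hahn_Banach_sublinear:
  assumes "sublinear p"
  obtains f where "linear f" "\<And>x. f x \<le> p x"
proof -
  obtain q where q: "sublinear q" "q \<le> p" and min: "\<And>r. sublinear r \<Longrightarrow> r \<le> q \<Longrightarrow> r = q"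
    using minimal_sublinear_exists[OF assms] by blast
  have "slope_minorant q z = q" for z
    using sublinear_slope_minorant[OF q(1)] slope_minorant_below[OF q(1)]
    by (intro min) (auto simp: le_fun_def)
  then have "q (- z) \<le> - q z" for z
    using slope_minorant_uminus[OF q(1)] by metis
  then have neg: "q (- z) = - q z" for z
    using sublinear_ge_uminus[OF q(1), of "- z"] by (force intro: antisym)
  have "q (x + y) = q x + q y" for x y
  proof (rule antisym)
    show "q (x + y) \<le> q x + q y"
      using q(1) unfolding sublinear_def by blast
    have "q ((x + y) + - y) \<le> q (x + y) + q (- y)"
      using q(1) unfolding sublinear_def by blast
    then show "q x + q y \<le> q (x + y)" by (simp add: neg)
  qed
  moreover have "q (c *\<^sub>R x) = c * q x" for c x
  proof (cases "0 \<le> c")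
    case False
    then have "q ((- c) *\<^sub>R x) = (- c) * q x"
      using q(1) unfolding sublinear_def by (meson linear neg_0_le_iff_le)
    then show ?thesis using neg[of "c *\<^sub>R x"] by simp
  qed (use q(1) in \<open>simp add: sublinear_def\<close>)
  ultimately have "linear q"
    by (intro linearI) auto
  then show thesis
    using q(2) by (intro that) (auto simp: le_fun_def)
qed

text \<open>Dominating f by \<open>slope_minorant norm x\<close> instead of \<open>norm\<close>
  forces f (- x) <= - norm x. The value at x is thus prescribed by the majorant, with no extension
  from a subspace.\<close>

corollary norming_functional_exists:
  fixes x :: "'a::real_normed_vector"
  obtains f :: "'a \<Rightarrow>\<^sub>L real" where "norm f \<le> 1" "blinfun_apply f x = norm x"
proof -
  have n: "sublinear (norm :: 'a \<Rightarrow> real)"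
    by (simp add: sublinear_def norm_triangle_ineq)
  obtain f where f: "linear f" and le: "\<And>y. f y \<le> slope_minorant norm x y"
    using Hahn_Banach_sublinear[OF sublinear_slope_minorant[OF n]] by blast
  have up: "f y \<le> norm y" for y
    using le slope_minorant_below[OF n] order_trans by blast
  have bound: "\<bar>f y\<bar> \<le> norm y" for y
    using up[of y] up[of "- y"] linear_neg[OF f, of y] by auto
  have bl: "bounded_linear f"
    using f bound by (intro bounded_linear.intro) (auto simp: bounded_linear_axioms_def linear_def intro: exI[of _ 1])
  show thesis
  proof (rule that[of "Blinfun f"])
    show "norm (Blinfun f) \<le> 1"
      by (rule norm_blinfun_bound) (use bound in \<open>auto simp: bounded_linear_Blinfun_apply[OF bl]\<close>)
    have "f (- x) \<le> - norm x"
      using le slope_minorant_uminus[OF n] order_trans by blast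
    then show "blinfun_apply (Blinfun f) x = norm x"
      using up[of x] linear_neg[OF f, of x] by (simp add: bounded_linear_Blinfun_apply[OF bl])
  qed
qed

subsection \<open>Infinite Ramsey theory\<close>

text \<open>Numbering the finitely many colours that occur reduces this to Ramsey's theorem for
  natural-number colours. The colours used later are pairs of truth values and functions on a finite
  grid.\<close>

lemma Ramsey_finite_colours:
  fixes c :: "nat set \<Rightarrow> 'c"
  assumes Z: "infinite Z" and fin: "finite (c ` {X. X \<subseteq> Z \<and> finite X \<and> card X = r})"
  obtains Y where "Y \<subseteq> Z" "infinite Y"
    "\<And>X X'. \<lbrakk>X \<subseteq> Y; finite X; card X = r; X' \<subseteq> Y; finite X'; card X' = r\<rbrakk> \<Longrightarrow> c X = c X'"
proof -
  let ?I = "c ` {X. X \<subseteq> Z \<and> finite X \<and> card X = r}"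
  obtain g :: "'c \<Rightarrow> nat" where g: "g ` ?I = {0..<card ?I}" "inj_on g ?I"
    using ex_bij_betw_finite_nat[OF fin] unfolding bij_betw_def by blast
  have "\<forall>X. X \<subseteq> Z \<and> finite X \<and> card X = r \<longrightarrow> (g \<circ> c) X < card ?I"
    using g(1) by fastforce
  from Ramsey[OF Z this] obtain Y t where Y: "Y \<subseteq> Z" "infinite Y"
    and t: "\<And>X. X \<subseteq> Y \<Longrightarrow> finite X \<Longrightarrow> card X = r \<Longrightarrow> g (c X) = t"
    by (auto simp: comp_def)
  show thesis
  proof (rule that[OF Y])
    fix X X' assume "X \<subseteq> Y" "finite X" "card X = r" "X' \<subseteq> Y" "finite X'" "card X' = r"
    with Y(1) t show "c X = c X'"
      by (intro inj_onD[OF g(2)]) auto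
  qed
qed

lemma strict_mono_range_le:
  fixes f g :: "nat \<Rightarrow> nat"
  assumes f: "strict_mono f" and g: "strict_mono g" and sub: "range g \<subseteq> range f"
  shows "f n \<le> g n"
proof -
  from sub have "\<forall>n. \<exists>i. g n = f i" by blast
  then obtain h where h: "\<And>n. g n = f (h n)" by metis
  have "strict_mono h"
    using g unfolding strict_mono_def h by (simp add: strict_mono_less[OF f])
  then have "n \<le> h n" by (rule seq_suble)
  then show ?thesis by (simp add: h strict_mono_less_eq[OF f])
qed

text \<open>The conclusion speaks of the exact tail from index l, not of a tail up to finitely many
  points; later estimates read their error off the starting index.\<close>

lemma diagonal_infinite_subset:
  fixes Q :: "nat \<Rightarrow> nat set \<Rightarrow> bool"
  assumes Z: "infinite Z"
    and refine: "\<And>l Y. infinite Y \<Longrightarrow> Y \<subseteq> Z \<Longrightarrow> \<exists>Y'\<subseteq>Y. infinite Y' \<and> Q l Y'"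
    and hered: "\<And>l Y Y'. Q l Y \<Longrightarrow> Y' \<subseteq> Y \<Longrightarrow> Q l Y'"
  obtains d :: "nat \<Rightarrow> nat" where "strict_mono d" "range d \<subseteq> Z" "\<And>l. Q l (d ` {l..})"
proof -
  let ?e = "enumerate Z"
  have e: "strict_mono ?e" "range ?e = Z"
    using Z by (simp_all add: strict_mono_enumerate range_enumerate)
  interpret subseqs "\<lambda>n s. Q n (range (?e \<circ> s))"
  proof
    fix n and s :: "nat \<Rightarrow> nat" assume s: "strict_mono s"
    have es: "strict_mono (?e \<circ> s)" by (rule strict_mono_o[OF e(1) s])
    then have "infinite (range (?e \<circ> s))"
      by (intro range_inj_infinite strict_mono_imp_inj_on)
    moreover have "range (?e \<circ> s) \<subseteq> Z" using e(2) by auto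
    ultimately obtain Y where Y: "Y \<subseteq> range (?e \<circ> s)" "infinite Y" "Q n Y"
      using refine by blast
    \<comment> \<open>\<open>Y\<close> is a subset of the current range, so its enumeration factors
      through \<open>?e \<circ> s\<close>; the factor is the next refinement of indices.\<close>
    define r where "r = inv (?e \<circ> s) \<circ> enumerate Y"
    have r: "(?e \<circ> s) (r i) = enumerate Y i" for i
      unfolding r_def comp_apply[of "inv _"]
      by (rule f_inv_into_f) (use Y enumerate_in_set in blast)
    have "strict_mono r"
      unfolding strict_mono_def strict_mono_less[OF es, symmetric, of "r _"] r
      using strict_mono_enumerate[OF Y(2)] by (simp add: strict_mono_def)
    moreover have "?e \<circ> (s \<circ> r) = enumerate Y" using r by auto
    then have "range (?e \<circ> (s \<circ> r)) = Y" by (simp only: range_enumerate[OF Y(2)])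
    ultimately show "\<exists>r' :: nat \<Rightarrow> nat. strict_mono r' \<and> Q n (range (?e \<circ> (s \<circ> r')))"
      using Y(3) by (intro exI[of _ r]) simp
  qed
  \<comment> \<open>The diagonal sequence is known to have property l only from index
    \<open>Suc l\<close> on; the shift by \<open>Suc\<close> makes this the tail of d from
    l.\<close>
  define d where "d = ?e \<circ> diagseq \<circ> Suc"
  have tail: "Q l (range (?e \<circ> (diagseq \<circ> (+) (Suc l))))" for l
    by (rule diagseq_holds, erule hered) auto
  have sub: "d ` {l..} \<subseteq> range (?e \<circ> (diagseq \<circ> (+) (Suc l)))" for l
  proof
    fix z assume "z \<in> d ` {l..}"
    then obtain i where "l \<le> i" "z = d i" by auto
    then have "z = (?e \<circ> (diagseq \<circ> (+) (Suc l))) (i - l)" by (simp add: d_def)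
    then show "z \<in> range (?e \<circ> (diagseq \<circ> (+) (Suc l)))" by blast
  qed
  have "Q l (d ` {l..})" for l by (rule hered[OF tail sub])
  moreover have "strict_mono d"
    unfolding d_def by (intro strict_mono_o e(1) subseq_diagseq) (simp add: strict_mono_Suc_iff)
  moreover have "range d \<subseteq> Z"
    using e(2) by (auto simp: d_def)
  ultimately show thesis using that by blast
qed

lemma refine_finitely_many:
  fixes R :: "nat \<Rightarrow> nat set \<Rightarrow> bool"
  assumes Z: "infinite Z"
    and refine: "\<And>m Y. infinite Y \<Longrightarrow> Y \<subseteq> Z \<Longrightarrow> \<exists>Y'\<subseteq>Y. infinite Y' \<and> R m Y'"
    and hered: "\<And>m Y Y'. R m Y \<Longrightarrow> Y' \<subseteq> Y \<Longrightarrow> R m Y'"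
  shows "\<exists>Y\<subseteq>Z. infinite Y \<and> (\<forall>m\<le>l. R m Y)"
proof (induction l)
  case 0
  then show ?case using refine[OF Z, of 0] by auto
next
  case (Suc l)
  then obtain Y where Y: "Y \<subseteq> Z" "infinite Y" "\<forall>m\<le>l. R m Y" by blast
  then obtain Y' where "Y' \<subseteq> Y" "infinite Y'" "R (Suc l) Y'" using refine by blast
  moreover from this Y(3) have "\<forall>m\<le>Suc l. R m Y'"
    by (auto simp: le_Suc_eq intro: hered[of _ Y Y'])
  ultimately show ?case using Y(1) by blast
qed

subsection \<open>Plegma families\<close>

lemma plegma_mono:
  assumes "plegma k ss" "i \<le> j" "j < length ss" "p < k"
  shows "ss ! i ! p \<le> ss ! j ! p"
  using assms(2,3)
proof (induction j rule: dec_induct)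
  case (step j)
  then have "ss ! j ! p < ss ! Suc j ! p"
    using assms unfolding plegma_def by blast
  with step show ?case by simp
qed simp

lemma plegma_less:
  assumes "plegma k ss" "i < j" "j < length ss" "p < k"
  shows "ss ! i ! p < ss ! j ! p"
proof -
  have "ss ! i ! p < ss ! Suc i ! p"
    using assms unfolding plegma_def by auto
  also have "\<dots> \<le> ss ! j ! p"
    using assms by (intro plegma_mono) auto
  finally show ?thesis .
qed

text \<open>The definition compares only the last member with the first. Monotonicity within each
  row carries this over to arbitrary members, in either order.\<close>

lemma plegma_interlaced:
  assumes "plegma k ss" "i < length ss" "j < length ss" "Suc p < k"
  shows "ss ! j ! p < ss ! i ! Suc p"
proof -
  have "ss \<noteq> []" using assms by auto
  have "ss ! j ! p \<le> ss ! (length ss - 1) ! p"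
    using assms by (intro plegma_mono) auto
  also have "\<dots> < ss ! 0 ! Suc p"
    using assms \<open>ss \<noteq> []\<close> unfolding plegma_def by (simp add: last_conv_nth hd_conv_nth)
  also have "\<dots> \<le> ss ! i ! Suc p"
    using assms by (intro plegma_mono) auto
  finally show ?thesis .
qed

lemma plegma_pair:
  assumes "plegma k ss" "i < j" "j < length ss"
  shows "plegma k [ss ! i, ss ! j]"
  using assms plegma_less[OF assms] plegma_interlaced[of k ss i j] unfolding plegma_def by simp

text \<open>Sorting the union of a plegma family of \<open>m\<close> sets lists first all first elements, then all
  second elements, and so on; hence the family can be read off its union.\<close>

definition plegma_of_set :: "nat \<Rightarrow> nat \<Rightarrow> nat set \<Rightarrow> nat list list" where
  "plegma_of_set m k X = map (\<lambda>j. map (\<lambda>i. sorted_list_of_set X ! (i * m + j)) [0..<k]) [0..<m]"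

text \<open>The n-th point of the sorted union is entry n div m of member n mod m. This enumeration
  increases inside a row by \<open>plegma_less\<close>, and from the end of a row to the start of
  the next by \<open>plegma_interlaced\<close>.\<close>

lemma plegma_of_set_surj:
  assumes pl: "plegma k ss" and len: "length ss = m" and sub: "set ss \<subseteq> ksubsets Y k"
  obtains X where "X \<subseteq> Y" "finite X" "card X = m * k" "plegma_of_set m k X = ss"
proof -
  define q where "q n = ss ! (n mod m) ! (n div m)" for n
  define L where "L = map q [0..<m * k]"
  have ss: "length (ss ! j) = k" "set (ss ! j) \<subseteq> Y" if "j < m" for j
    using that subsetD[OF sub nth_mem, of j] len by (auto simp: ksubsets_def)
  have m: "0 < m" and div: "n div m < k" if "n < m * k" for n
    using that by (auto simp: less_mult_imp_div_less mult.commute intro: gr0I)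
  have "q n < q (Suc n)" if "Suc n < m * k" for n
  proof (cases "Suc (n mod m) = m")
    case True
    then have "Suc n mod m = 0" "Suc n div m = Suc (n div m)"
      by (auto simp: mod_Suc div_Suc)
    with True show ?thesis
      using plegma_interlaced[OF pl, of 0 "n mod m" "n div m"] div[OF that] m[OF that] len
      by (simp add: q_def)
  next
    case False
    then have "Suc n mod m = Suc (n mod m)" "Suc n div m = n div m"
      by (auto simp: mod_Suc div_Suc)
    moreover have "Suc (n mod m) < m"
      using False m[OF that] mod_less_divisor[of m n] by linarith
    ultimately show ?thesis
      using plegma_less[OF pl, of "n mod m" "Suc (n mod m)" "n div m"] div[OF that] len
      by (simp add: q_def)
  qed
  then have sorted: "sorted_wrt (<) L"
    unfolding L_def by (subst sorted_wrt_iff_nth_Suc_transp) auto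
  then have slist: "sorted_list_of_set (set L) = L"
    by (simp add: strict_sorted_iff sorted_list_of_set.idem_if_sorted_distinct)
  show thesis
  proof (rule that[of "set L"])
    show "set L \<subseteq> Y"
    proof
      fix z assume "z \<in> set L"
      then obtain n where n: "n < m * k" "z = q n" by (auto simp: L_def)
      then have "n mod m < m" "n div m < k" using m div by auto
      then show "z \<in> Y" using ss[of "n mod m"] n nth_mem[of "n div m" "ss ! (n mod m)"]
        by (auto simp: q_def)
    qed
    show "card (set L) = m * k"
      using sorted by (simp add: distinct_card strict_sorted_iff) (simp add: L_def)
    show "plegma_of_set m k (set L) = ss"
    proof (rule nth_equalityI)
      fix j assume "j < length (plegma_of_set m k (set L))"
      then have j: "j < m" by (simp add: plegma_of_set_def)
      show "plegma_of_set m k (set L) ! j = ss ! j"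
      proof (rule nth_equalityI)
        fix i assume "i < length (plegma_of_set m k (set L) ! j)"
        then have i: "i < k" using j by (simp add: plegma_of_set_def)
        have "i * m + j < Suc i * m" using j by simp
        also have "\<dots> \<le> m * k" using i by (metis Suc_leI mult.commute mult_le_mono2)
        finally have "i * m + j < m * k" .
        then show "plegma_of_set m k (set L) ! j ! i = ss ! j ! i"
          using i j by (simp add: plegma_of_set_def slist) (simp add: L_def q_def)
      qed (use j ss in \<open>simp add: plegma_of_set_def\<close>)
    qed (simp add: plegma_of_set_def len)
  qed simp
qed

text \<open>Sets of m * k points receive the colour of the family read off from them. Surjectivity
  is what transfers homogeneity: every plegma family in \<open>Y\<close> comes from a subset of
  \<open>Y\<close>.\<close>

lemma plegma_Ramsey:
  fixes c :: "nat list list \<Rightarrow> 'c"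
  assumes "infinite Z" and fin: "finite (c ` {ss. length ss = m})"
  obtains Y where "Y \<subseteq> Z" "infinite Y"
    "\<And>ss tt. \<lbrakk>length ss = m; set ss \<subseteq> ksubsets Y k; plegma k ss;
        length tt = m; set tt \<subseteq> ksubsets Y k; plegma k tt\<rbrakk> \<Longrightarrow> c ss = c tt"
proof -
  have fin': "finite ((c \<circ> plegma_of_set m k) ` {X. X \<subseteq> Z \<and> finite X \<and> card X = m * k})"
    by (rule finite_subset[OF _ fin]) (auto simp: plegma_of_set_def)
  show thesis
  proof (rule Ramsey_finite_colours[OF assms(1) fin'], rule that)
    fix Y
    assume hom: "\<And>X X'. \<lbrakk>X \<subseteq> Y; finite X; card X = m * k; X' \<subseteq> Y; finite X'; card X' = m * k\<rbrakk> \<Longrightarrow>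
      (c \<circ> plegma_of_set m k) X = (c \<circ> plegma_of_set m k) X'"
    fix ss tt
    assume "length ss = m" "set ss \<subseteq> ksubsets Y k" "plegma k ss"
      "length tt = m" "set tt \<subseteq> ksubsets Y k" "plegma k tt"
    note ss = this
    obtain X where "X \<subseteq> Y" "finite X" "card X = m * k" "plegma_of_set m k X = ss"
      by (rule plegma_of_set_surj[OF ss(3,1,2)])
    moreover obtain X' where "X' \<subseteq> Y" "finite X'" "card X' = m * k" "plegma_of_set m k X' = tt"
      by (rule plegma_of_set_surj[OF ss(6,4,5)])
    ultimately show "c ss = c tt" using hom[of X X'] by auto
  qed
qed

text \<open>Row i occupies w consecutive indices starting at b + i * w, and j is the position inside
  the row. Hence the lists with j < w interlace.\<close>

definition block :: "(nat \<Rightarrow> nat) \<Rightarrow> nat \<Rightarrow> nat \<Rightarrow> nat \<Rightarrow> nat \<Rightarrow> nat list" where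
  "block d k w b j = map (\<lambda>i. d (b + i * w + j)) [0..<k]"

lemma plegma_blocks:
  assumes d: "strict_mono d" and "m \<le> w"
  shows "plegma k (map (block d k w b) [0..<m])"
  unfolding plegma_def
proof (intro conjI allI impI)
  fix i assume *: "map (block d k w b) [0..<m] \<noteq> []" "Suc i < k"
  then show "last (map (block d k w b) [0..<m]) ! i < hd (map (block d k w b) [0..<m]) ! Suc i"
    using assms by (simp add: last_conv_nth hd_conv_nth block_def strict_mono_less[OF d])
qed (use assms in \<open>auto simp: block_def strict_mono_less[OF d]\<close>)

lemma block_in_ksubsets:
  assumes d: "strict_mono d" and "0 < w"
  shows "block d k w b j \<in> ksubsets (d ` {b..}) k"
  using assms
  by (auto simp: ksubsets_def block_def sorted_wrt_iff_nth_less strict_mono_less[OF d])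

section \<open>Stabilising the norms of combinations along plegma families\<close>

lemma ksubsets_mono: "Y \<subseteq> Z \<Longrightarrow> ksubsets Y k \<subseteq> ksubsets Z k"
  by (auto simp: ksubsets_def)

definition plegma_stable :: "nat \<Rightarrow> (nat list \<Rightarrow> 'b::real_normed_vector) \<Rightarrow> nat \<Rightarrow> real \<Rightarrow> nat set \<Rightarrow> bool" where
  "plegma_stable k y m \<epsilon> Y \<longleftrightarrow> (\<forall>ss tt a.
     length ss = m \<and> set ss \<subseteq> ksubsets Y k \<and> plegma k ss \<and>
     length tt = m \<and> set tt \<subseteq> ksubsets Y k \<and> plegma k tt \<and> (\<forall>j<m. \<bar>a j\<bar> \<le> 1) \<longrightarrow>
     \<bar>norm (\<Sum>j<m. a j *\<^sub>R y (ss ! j)) - norm (\<Sum>j<m. a j *\<^sub>R y (tt ! j))\<bar> \<le> \<epsilon>)"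

lemma plegma_stable_subset:
  assumes st: "plegma_stable k y m \<epsilon> Y" and "Y' \<subseteq> Y"
  shows "plegma_stable k y m \<epsilon> Y'"
  unfolding plegma_stable_def
proof (intro allI impI, elim conjE)
  fix ss tt and a :: "nat \<Rightarrow> real"
  assume "set ss \<subseteq> ksubsets Y' k" "set tt \<subseteq> ksubsets Y' k"
  then have "set ss \<subseteq> ksubsets Y k" "set tt \<subseteq> ksubsets Y k"
    using ksubsets_mono[OF assms(2)] by blast+
  moreover assume "length ss = m" "plegma k ss" "length tt = m" "plegma k tt" "\<forall>j<m. \<bar>a j\<bar> \<le> 1"
  ultimately show "\<bar>norm (\<Sum>j<m. a j *\<^sub>R y (ss ! j)) - norm (\<Sum>j<m. a j *\<^sub>R y (tt ! j))\<bar> \<le> \<epsilon>"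
    using st unfolding plegma_stable_def by blast
qed

lemma norm_sum_scaleR_le:
  fixes y :: "nat \<Rightarrow> 'b::real_normed_vector"
  assumes "\<And>j. norm (y j) \<le> 1"
  shows "norm (\<Sum>j<m. a j *\<^sub>R y j) \<le> (\<Sum>j<m. \<bar>a j\<bar>)"
proof -
  have "norm (\<Sum>j<m. a j *\<^sub>R y j) \<le> (\<Sum>j<m. norm (a j *\<^sub>R y j))" by (rule norm_sum)
  also have "\<dots> \<le> (\<Sum>j<m. \<bar>a j\<bar>)"
    using assms by (intro sum_mono) (simp add: mult_left_le)
  finally show ?thesis .
qed

text \<open>Ramsey's theorem is applied to the norms of the combinations with coefficients in the grid
  \<open>{i/n. \<bar>i\<bar> \<le> n}\<close>, rounded down to multiples of \<open>1/n\<close>.\<close>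

lemma plegma_stable_refine:
  fixes y :: "nat list \<Rightarrow> 'b::real_normed_vector"
  assumes y: "\<And>s. norm (y s) \<le> 1" and Z: "infinite Z" and "0 < \<epsilon>"
  shows "\<exists>Y\<subseteq>Z. infinite Y \<and> plegma_stable k y m \<epsilon> Y"
proof -
  \<comment> \<open>Rounding the coefficients costs at most m/n for each of the two families, and
    equal integer parts leave a difference of at most 1/n: together (2m + 1)/n.\<close>
  obtain n :: nat where n: "(2 * real m + 1) / \<epsilon> < n" using reals_Archimedean2 by blast
  have "0 < (2 * real m + 1) / \<epsilon>" using \<open>0 < \<epsilon>\<close> by simp
  with n have n0: "0 < real n" by linarith
  have n\<epsilon>: "(2 * real m + 1) / n \<le> \<epsilon>" using n n0 \<open>0 < \<epsilon>\<close> by (simp add: field_simps)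
  define G where "G = {..<m} \<rightarrow>\<^sub>E (\<lambda>i. real_of_int i / n) ` {- int n..int n}"
  have "finite G" unfolding G_def by (intro finite_PiE) auto
  define v where "v ss a = norm (\<Sum>j<m. a j *\<^sub>R y (ss ! j))" for ss a
  define c where "c ss = restrict (\<lambda>a. \<lfloor>n * v ss a\<rfloor>) G" for ss
  have "c ss \<in> G \<rightarrow>\<^sub>E {0..int (n * m)}" for ss
  proof -
    have "\<lfloor>n * v ss a\<rfloor> \<in> {0..int (n * m)}" if "a \<in> G" for a
    proof -
      have "\<bar>a j\<bar> \<le> 1" if "j < m" for j
      proof -
        have "a j \<in> (\<lambda>i. real_of_int i / n) ` {- int n..int n}"
          using \<open>a \<in> G\<close> that unfolding G_def by (intro PiE_mem[of a]) auto
        then obtain i where "a j = real_of_int i / n" "i \<in> {- int n..int n}" by blast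
        moreover from this(2) have "\<bar>real_of_int i\<bar> \<le> real n" by auto
        ultimately show ?thesis using n0 by simp
      qed
      then have "(\<Sum>j<m. \<bar>a j\<bar>) \<le> (\<Sum>j<m. 1)" by (intro sum_mono) auto
      then have "v ss a \<le> m"
        using norm_sum_scaleR_le[of "\<lambda>j. y (ss ! j)" a m] y by (simp add: v_def)
      then have "n * v ss a \<le> real (n * m)" using n0 by simp
      moreover have "0 \<le> n * v ss a" by (simp add: v_def)
      ultimately show ?thesis by (simp add: floor_le_iff)
    qed
    then show ?thesis unfolding c_def by (intro restrict_PiE_iff[THEN iffD2]) blast
  qed
  then have "c ` {ss. length ss = m} \<subseteq> G \<rightarrow>\<^sub>E {0..int (n * m)}" by blast
  moreover have "finite (G \<rightarrow>\<^sub>E {0..int (n * m)})"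
    using \<open>finite G\<close> by (intro finite_PiE) auto
  ultimately have fin: "finite (c ` {ss. length ss = m})" by (rule finite_subset)
  show ?thesis
  proof (rule plegma_Ramsey[OF Z fin, where k = k], intro exI conjI)
    fix Y
    assume hom: "\<And>ss tt. \<lbrakk>length ss = m; set ss \<subseteq> ksubsets Y k; plegma k ss;
        length tt = m; set tt \<subseteq> ksubsets Y k; plegma k tt\<rbrakk> \<Longrightarrow> c ss = c tt"
    show "plegma_stable k y m \<epsilon> Y"
      unfolding plegma_stable_def
    proof (intro allI impI, elim conjE)
      fix ss tt and a :: "nat \<Rightarrow> real"
      assume "length ss = m" "set ss \<subseteq> ksubsets Y k" "plegma k ss"
        "length tt = m" "set tt \<subseteq> ksubsets Y k" "plegma k tt"
      then have cc: "c ss = c tt" by (rule hom)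
      assume a: "\<forall>j<m. \<bar>a j\<bar> \<le> 1"
      define b where "b = restrict (\<lambda>j. real_of_int \<lfloor>n * a j\<rfloor> / n) {..<m}"
      have ab: "\<bar>a j - b j\<bar> \<le> 1 / n" if "j < m" for j
      proof -
        have "\<bar>n * a j - real_of_int \<lfloor>n * a j\<rfloor>\<bar> \<le> 1" by linarith
        moreover have "a j - b j = (n * a j - real_of_int \<lfloor>n * a j\<rfloor>) / n"
          using that n0 by (simp add: b_def field_simps)
        ultimately show ?thesis using n0 by (simp add: divide_right_mono)
      qed
      have "b \<in> G"
        unfolding G_def b_def
      proof (intro restrict_PiE_iff[THEN iffD2] ballI imageI)
        fix j assume "j \<in> {..<m}"
        then have "\<bar>real n * a j\<bar> \<le> real n" using a n0 by (simp add: abs_mult mult_left_le)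
        then have "- real n \<le> real n * a j" "real n * a j \<le> real n" by linarith+
        then have "- int n \<le> \<lfloor>real n * a j\<rfloor>" "\<lfloor>real n * a j\<rfloor> \<le> int n"
          by (simp_all add: le_floor_iff floor_le_iff)
        then show "\<lfloor>real n * a j\<rfloor> \<in> {- int n..int n}" by simp
      qed
      then have "\<lfloor>n * v ss b\<rfloor> = \<lfloor>n * v tt b\<rfloor>"
        using fun_cong[OF cc, of b] by (simp add: c_def)
      then have "\<bar>n * v ss b - n * v tt b\<bar> \<le> 1" by linarith
      then have "n * \<bar>v ss b - v tt b\<bar> \<le> 1"
        using n0 by (simp add: abs_mult flip: right_diff_distrib)
      then have vb: "\<bar>v ss b - v tt b\<bar> \<le> 1 / n" using n0 by (simp add: field_simps)
      have va: "\<bar>v rr a - v rr b\<bar> \<le> m / n" for rr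
      proof -
        have "\<bar>v rr a - v rr b\<bar> \<le> norm (\<Sum>j<m. (a j - b j) *\<^sub>R y (rr ! j))"
          unfolding v_def scaleR_left_diff_distrib sum_subtractf by (rule norm_triangle_ineq3)
        also have "\<dots> \<le> (\<Sum>j<m. \<bar>a j - b j\<bar>)"
          using y by (rule norm_sum_scaleR_le)
        also have "\<dots> \<le> (\<Sum>j<m. 1 / n)" using ab by (intro sum_mono) auto
        finally show ?thesis by simp
      qed
      have "\<bar>v ss a - v tt a\<bar> \<le> (2 * real m + 1) / n"
        using va[of ss] va[of tt] vb by (simp add: add_divide_distrib)
      also note n\<epsilon>
      finally show "\<bar>norm (\<Sum>j<m. a j *\<^sub>R y (ss ! j)) - norm (\<Sum>j<m. a j *\<^sub>R y (tt ! j))\<bar> \<le> \<epsilon>"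
        by (simp add: v_def)
    qed
  qed
qed

subsection \<open>Generating spreading models\<close>

lemma lookup_scaleR: "Poly_Mapping.lookup (c *\<^sub>R p) i = c *\<^sub>R Poly_Mapping.lookup p i"
  by (simp add: scaleR_poly_mapping_def)

lemma lookup_sum_scaleR_single:
  fixes m :: nat
  shows "Poly_Mapping.lookup (\<Sum>j<m. a j *\<^sub>R Poly_Mapping.single j (1::real)) i = (if i < m then a i else 0)"
proof -
  have "Poly_Mapping.lookup (\<Sum>j<m. a j *\<^sub>R Poly_Mapping.single j (1::real)) i =
      (\<Sum>j<m. if j = i then a j else 0)"
    unfolding lookup_sum lookup_scaleR lookup_single when_def by (rule sum.cong) auto
  then show ?thesis by simp
qed

lemma hamel_basis_single: "hamel_basis (\<lambda>n. Poly_Mapping.single n (1::real))"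
  unfolding hamel_basis_def
proof (intro conjI)
  let ?e = "\<lambda>n::nat. Poly_Mapping.single n (1::real)"
  have inj: "?e i = ?e j \<longleftrightarrow> i = j" for i j
    by (metis lookup_single_eq lookup_single_not_eq zero_neq_one)
  then show "inj ?e" by (simp add: inj_on_def)
  show "independent (range ?e)"
    unfolding independent_explicit_module
  proof (intro allI impI)
    fix t u v assume t: "finite t" "t \<subseteq> range ?e" "(\<Sum>v\<in>t. u v *\<^sub>R v) = 0" "v \<in> t"
    then obtain n where n: "v = ?e n" by auto
    have "Poly_Mapping.lookup w n = (if w = v then 1 else 0)" if "w \<in> t" for w
    proof -
      from that t(2) obtain i where "w = ?e i" by auto
      then show ?thesis using n inj by (simp add: lookup_single when_def)
    qed
    then have "(\<Sum>w\<in>t. u w * Poly_Mapping.lookup w n) = (\<Sum>w\<in>t. if w = v then u w else 0)"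
      by (intro sum.cong) auto
    also have "\<dots> = u v" using t by simp
    finally have "u v = Poly_Mapping.lookup (\<Sum>w\<in>t. u w *\<^sub>R w) n"
      by (simp add: lookup_sum lookup_scaleR)
    then show "u v = 0" using t by simp
  qed
  have "p \<in> span (range ?e)" for p
  proof -
    have "p = (\<Sum>i\<in>Poly_Mapping.keys p. Poly_Mapping.lookup p i *\<^sub>R ?e i)"
      by (rule poly_mapping_eqI)
        (simp add: lookup_sum lookup_scaleR lookup_single when_def if_distrib in_keys_iff cong: if_cong)
    then show ?thesis
      by (metis (no_types, lifting) rangeI span_base span_scale span_sum)
  qed
  then show "span (range ?e) = UNIV" by blast
qed

text \<open>Dividing by K brings the coefficients into [-1,1], the range in which
  \<open>plegma_stable\<close> gives information; 1 <= K makes the division safe, also for the zero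
  vector.\<close>

lemma poly_mapping_nat_bounds:
  fixes p :: "nat \<Rightarrow>\<^sub>0 real"
  obtains m K where "\<And>j. m \<le> j \<Longrightarrow> Poly_Mapping.lookup p j = 0" "1 \<le> K" "\<And>j. \<bar>Poly_Mapping.lookup p j\<bar> \<le> K"
proof (rule that)
  fix j assume "Suc (Max (insert 0 (Poly_Mapping.keys p))) \<le> j"
  then have "\<not> j \<le> Max (insert 0 (Poly_Mapping.keys p))" by linarith
  moreover have "j \<le> Max (insert 0 (Poly_Mapping.keys p))" if "j \<in> Poly_Mapping.keys p"
    using that by (intro Max_ge) auto
  ultimately have "j \<notin> Poly_Mapping.keys p" by blast
  then show "Poly_Mapping.lookup p j = 0" by (simp add: in_keys_iff)
next
  show "1 \<le> 1 + (\<Sum>i\<in>Poly_Mapping.keys p. \<bar>Poly_Mapping.lookup p i\<bar>)" by (simp add: sum_nonneg)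
  fix j
  show "\<bar>Poly_Mapping.lookup p j\<bar> \<le> 1 + (\<Sum>i\<in>Poly_Mapping.keys p. \<bar>Poly_Mapping.lookup p i\<bar>)"
  proof (cases "j \<in> Poly_Mapping.keys p")
    case True
    then show ?thesis
      using member_le_sum[of j "Poly_Mapping.keys p" "\<lambda>i. \<bar>Poly_Mapping.lookup p i\<bar>"] by simp
  next
    case False
    then have "Poly_Mapping.lookup p j = 0" by (simp add: in_keys_iff)
    then show ?thesis by (simp add: sum_nonneg)
  qed
qed

text \<open>The limit of the seminorms induced by the particular plegma families of width \<open>N\<close>
  starting at the \<open>N\<close>-th point; being a limit of seminorms it is a seminorm.\<close>

definition block_norm ::
  "nat \<Rightarrow> (nat list \<Rightarrow> 'b::real_normed_vector) \<Rightarrow> (nat \<Rightarrow> nat) \<Rightarrow> nat \<Rightarrow> (nat \<Rightarrow>\<^sub>0 real) \<Rightarrow> real" where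
  "block_norm k y d N p = norm (\<Sum>j<N. Poly_Mapping.lookup p j *\<^sub>R y (block d k N N j))"

definition limit_norm ::
  "nat \<Rightarrow> (nat list \<Rightarrow> 'b::real_normed_vector) \<Rightarrow> (nat \<Rightarrow> nat) \<Rightarrow> (nat \<Rightarrow>\<^sub>0 real) \<Rightarrow> real" where
  "limit_norm k y d p = lim (\<lambda>N. block_norm k y d N p)"

text \<open>Summing up to N makes \<open>block_norm\<close> a seminorm in p without reference to
  supports. Here the sum is cut back to a fixed length m, as the stability estimates
  require.\<close>

lemma block_norm_finite_support:
  assumes "\<And>j. m \<le> j \<Longrightarrow> Poly_Mapping.lookup p j = 0" and "m \<le> N"
  shows "block_norm k y d N p = norm (\<Sum>j<m. Poly_Mapping.lookup p j *\<^sub>R y (block d k N N j))"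
  unfolding block_norm_def
  by (rule arg_cong[where f = norm], rule sum.mono_neutral_right) (use assms in auto)

lemma set_blocks_subset:
  assumes "strict_mono d" "l \<le> N" "m \<le> N"
  shows "set (map (block d k N N) [0..<m]) \<subseteq> ksubsets (d ` {l..}) k"
proof
  fix s assume s: "s \<in> set (map (block d k N N) [0..<m])"
  then have "0 < N" using assms(3) by auto
  moreover have "ksubsets (d ` {N..}) k \<subseteq> ksubsets (d ` {l..}) k"
    using assms(2) by (intro ksubsets_mono image_mono) auto
  ultimately show "s \<in> ksubsets (d ` {l..}) k"
    using s block_in_ksubsets[OF assms(1), of N k N] by auto
qed

text \<open>For N and N' beyond l both block families lie in the tail from l, so after scaling their
  norms differ by at most 1/(l+1): the values form a Cauchy sequence.\<close>

lemma block_norm_convergent: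
  assumes d: "strict_mono d"
    and stable: "\<And>l m. m \<le> Suc l \<Longrightarrow> plegma_stable k y m (1 / real (Suc l)) (d ` {l..})"
  shows "(\<lambda>N. block_norm k y d N p) \<longlonglongrightarrow> limit_norm k y d p"
proof -
  obtain m K where m: "\<And>j. m \<le> j \<Longrightarrow> Poly_Mapping.lookup p j = 0" and K: "1 \<le> K" "\<And>j. \<bar>Poly_Mapping.lookup p j\<bar> \<le> K"
    using poly_mapping_nat_bounds by blast
  define a where "a j = Poly_Mapping.lookup p j / K" for j
  have a: "\<bar>a j\<bar> \<le> 1" for j using K(1) K(2)[of j] by (simp add: a_def)
  define g where "g N = norm (\<Sum>j<m. a j *\<^sub>R y (block d k N N j))" for N
  have bg: "block_norm k y d N p = K * g N" if "m \<le> N" for N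
  proof -
    have "(\<Sum>j<m. Poly_Mapping.lookup p j *\<^sub>R y (block d k N N j)) = K *\<^sub>R (\<Sum>j<m. a j *\<^sub>R y (block d k N N j))"
      using K(1) by (simp add: scaleR_sum_right a_def)
    then show ?thesis
      using K(1) block_norm_finite_support[OF m that, where k = k and y = y and d = d] by (simp add: g_def)
  qed
  have g_close: "\<bar>g N - g N'\<bar> \<le> 1 / real (Suc l)" if "m \<le> l" "l \<le> N" "l \<le> N'" for l N N'
  proof -
    have "plegma_stable k y m (1 / real (Suc l)) (d ` {l..})"
      using that by (intro stable) auto
    from this[unfolded plegma_stable_def, rule_format,
        of "map (block d k N N) [0..<m]" "map (block d k N' N') [0..<m]" a]
    show ?thesis
      using a that plegma_blocks[OF d] set_blocks_subset[OF d] unfolding g_def by simp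
  qed
  have "Cauchy g"
  proof (rule CauchyI)
    fix \<epsilon> :: real assume "0 < \<epsilon>"
    then obtain n where n: "1 / real (Suc n) < \<epsilon>"
      using nat_approx_posE by blast
    have "\<bar>g N - g N'\<bar> < \<epsilon>" if "max m n \<le> N" "max m n \<le> N'" for N N'
    proof -
      have "\<bar>g N - g N'\<bar> \<le> 1 / real (Suc (max m n))" using that by (intro g_close) auto
      also have "\<dots> \<le> 1 / real (Suc n)" by (intro divide_left_mono) auto
      finally show ?thesis using n by linarith
    qed
    then show "\<exists>M. \<forall>N\<ge>M. \<forall>N'\<ge>M. norm (g N - g N') < \<epsilon>"
      by (intro exI[of _ "max m n"]) simp
  qed
  then obtain L where "g \<longlonglongrightarrow> L" using real_Cauchy_convergent convergent_def by blast
  then have "(\<lambda>N. K * g N) \<longlonglongrightarrow> K * L" by (rule tendsto_mult_left)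
  then have "(\<lambda>N. block_norm k y d N p) \<longlonglongrightarrow> K * L"
    by (rule Lim_transform_eventually) (use bg in \<open>auto simp: eventually_sequentially intro!: exI[of _ m]\<close>)
  then show ?thesis
    unfolding limit_norm_def using convergentI convergent_LIMSEQ_iff by blast
qed

lemma seminorm_limit_norm:
  assumes conv: "\<And>p. (\<lambda>N. block_norm k y d N p) \<longlonglongrightarrow> limit_norm k y d p"
  shows "seminorm (limit_norm k y d)"
  unfolding seminorm_def
proof (intro conjI allI)
  fix p q :: "nat \<Rightarrow>\<^sub>0 real" and c :: real
  show "0 \<le> limit_norm k y d p"
    by (rule LIMSEQ_le_const[OF conv]) (simp add: block_norm_def)
  have "block_norm k y d N (c *\<^sub>R p) = \<bar>c\<bar> * block_norm k y d N p" for N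
    unfolding block_norm_def lookup_scaleR real_scaleR_def norm_scaleR[symmetric] scaleR_sum_right
    by simp
  then have "(\<lambda>N. block_norm k y d N (c *\<^sub>R p)) \<longlonglongrightarrow> \<bar>c\<bar> * limit_norm k y d p"
    using tendsto_mult_left[OF conv] by simp
  then show "limit_norm k y d (c *\<^sub>R p) = \<bar>c\<bar> * limit_norm k y d p"
    using LIMSEQ_unique conv by blast
  have "block_norm k y d N (p + q) \<le> block_norm k y d N p + block_norm k y d N q" for N
    unfolding block_norm_def lookup_add scaleR_add_left sum.distrib by (rule norm_triangle_ineq)
  then show "limit_norm k y d (p + q) \<le> limit_norm k y d p + limit_norm k y d q"
    by (intro LIMSEQ_le[OF conv tendsto_add[OF conv conv]]) auto
qed

text \<open>A given family is compared with block families starting arbitrarily late; the bound does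
  not depend on N and survives the limit.\<close>

lemma generates_limit_norm:
  assumes k: "1 \<le> k" and d: "strict_mono d"
    and stable: "\<And>l m. m \<le> Suc l \<Longrightarrow> plegma_stable k y m (1 / real (Suc l)) (d ` {l..})"
  shows "generates_ksm k y (\<lambda>n. Poly_Mapping.single n 1) (limit_norm k y d)"
  unfolding generates_ksm_def
proof (intro exI conjI allI impI; (elim conjE)?)
  show inf: "infinite (range d)"
    using d by (intro range_inj_infinite strict_mono_imp_inj_on)
  \<comment> \<open>The error obtained below is 1/l. The sequence 2/(l+1) dominates it for l >= 1
    and is positive at l = 0 too.\<close>
  have "(\<lambda>l. 2 * inverse (real (Suc l))) \<longlonglongrightarrow> 2 * 0"
    by (intro tendsto_mult_left LIMSEQ_inverse_real_of_nat)
  then show "(\<lambda>l. 2 * inverse (real (Suc l))) \<longlonglongrightarrow> 0" by simp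
  fix l m :: nat and ss and a :: "nat \<Rightarrow> real"
  assume l: "1 \<le> l" and ml: "m \<le> l" and len: "length ss = m"
    and sub: "set ss \<subseteq> ksubsets (range d) k" and pl: "plegma k ss"
    and hd: "ss \<noteq> [] \<longrightarrow> enumerate (range d) (l - 1) \<le> hd ss ! 0"
    and a: "\<forall>j<m. \<bar>a j\<bar> \<le> 1"
  \<comment> \<open>The l-th element has index l - 1. The first entry of the first member is the
    least entry of the family, so the whole family lies in the tail from h, whose stability covers
    lengths up to h + 1 = l.\<close>
  define h where "h = l - 1"
  have Such: "Suc h = l" using l by (simp add: h_def)
  have dh: "d h \<le> enumerate (range d) h"
    using inf by (intro strict_mono_range_le d) (simp_all add: strict_mono_enumerate range_enumerate)
  have sub': "set ss \<subseteq> ksubsets (d ` {h..}) k"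
  proof
    fix s assume s: "s \<in> set ss"
    then obtain j where j: "j < length ss" "s = ss ! j" by (auto simp: in_set_conv_nth)
    have sk: "sorted_wrt (<) s" "length s = k" "set s \<subseteq> range d"
      using s sub by (auto simp: ksubsets_def)
    have "set s \<subseteq> d ` {h..}"
    proof
      fix z assume z: "z \<in> set s"
      then obtain n where n: "z = d n" using sk by blast
      have "d h \<le> ss ! 0 ! 0"
        using dh hd s by (cases ss) (auto simp: h_def)
      also have "\<dots> \<le> s ! 0"
        using j k pl by (auto intro: plegma_mono)
      also have "\<dots> \<le> z"
        using z sk(1) by (cases s) auto
      finally have "h \<le> n" using n by (simp add: strict_mono_less_eq[OF d])
      with n show "z \<in> d ` {h..}" by auto
    qed
    with sk show "s \<in> ksubsets (d ` {h..}) k" by (simp add: ksubsets_def)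
  qed
  let ?p = "\<Sum>j<m. a j *\<^sub>R Poly_Mapping.single j (1::real)"
  let ?A = "norm (\<Sum>j<m. a j *\<^sub>R y (ss ! j))"
  have "\<bar>?A - block_norm k y d N ?p\<bar> \<le> 1 / real l" if "l \<le> N" for N
  proof -
    have *: "block_norm k y d N ?p = norm (\<Sum>j<m. a j *\<^sub>R y (block d k N N j))"
      using that ml by (subst block_norm_finite_support[of m]) (auto simp: lookup_sum_scaleR_single)
    have "plegma_stable k y m (1 / real (Suc h)) (d ` {h..})"
      using ml Such by (intro stable) auto
    from this[unfolded plegma_stable_def, rule_format, of ss "map (block d k N N) [0..<m]" a]
    show ?thesis
      using a that ml len sub' pl plegma_blocks[OF d] set_blocks_subset[OF d, of h N m k]
      unfolding * Such by (simp add: h_def)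
  qed
  then have "\<bar>?A - limit_norm k y d ?p\<bar> \<le> 1 / real l"
    by (intro LIMSEQ_le_const2[OF tendsto_rabs[OF tendsto_diff[OF tendsto_const
        block_norm_convergent[OF d stable]]]]) auto
  also have "\<dots> \<le> 2 * inverse (real (Suc l))"
    using l by (simp add: field_simps)
  finally show "\<bar>?A - limit_norm k y d ?p\<bar> \<le> 2 * inverse (real (Suc l))" .
qed auto

subsection \<open>The estimates\<close>

text \<open>Evaluated at the signed sum of the x i, the term a j y j contributes at least c times
  the modulus of a j from the diagonal and loses at most m * eta times that modulus off it. The
  total is at most K times the norm of the functional.\<close>

lemma l1_lower_bound:
  fixes y :: "nat \<Rightarrow> 'a::real_normed_vector \<Rightarrow>\<^sub>L real" and x :: "nat \<Rightarrow> 'a"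
  assumes diag: "\<And>j. j < m \<Longrightarrow> c \<le> blinfun_apply (y j) (x j)"
    and off: "\<And>i j. i < m \<Longrightarrow> j < m \<Longrightarrow> i \<noteq> j \<Longrightarrow> \<bar>blinfun_apply (y j) (x i)\<bar> \<le> \<eta>"
    and \<eta>: "0 \<le> \<eta>" and K: "norm (\<Sum>i<m. sgn (a i) *\<^sub>R x i) \<le> K"
  shows "(c - m * \<eta>) * (\<Sum>j<m. \<bar>a j\<bar>) \<le> K * norm (\<Sum>j<m. a j *\<^sub>R y j)"
proof -
  let ?S = "\<Sum>i<m. sgn (a i) *\<^sub>R x i" and ?F = "\<Sum>j<m. a j *\<^sub>R y j"
  have "(c - m * \<eta>) * \<bar>a j\<bar> \<le> a j * blinfun_apply (y j) ?S" if j: "j < m" for j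
  proof -
    define R where "R = (\<Sum>i\<in>{..<m} - {j}. sgn (a i) * blinfun_apply (y j) (x i))"
    have S: "blinfun_apply (y j) ?S = sgn (a j) * blinfun_apply (y j) (x j) + R"
      unfolding R_def blinfun.sum_right blinfun.scaleR_right real_scaleR_def
      using j by (intro sum.remove) auto
    have "\<bar>R\<bar> \<le> (\<Sum>i\<in>{..<m} - {j}. \<eta>)"
      unfolding R_def
    proof (rule order_trans[OF sum_abs sum_mono])
      fix i assume "i \<in> {..<m} - {j}"
      then have "\<bar>blinfun_apply (y j) (x i)\<bar> \<le> \<eta>" using j off by auto
      then show "\<bar>sgn (a i) * blinfun_apply (y j) (x i)\<bar> \<le> \<eta>"
        using \<eta> by (cases "a i = 0") (auto simp: abs_mult)
    qed
    also have "\<dots> \<le> m * \<eta>"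
      using \<eta> card_mono[of "{..<m}" "{..<m} - {j}"] by (simp add: mult_right_mono del: card_Diff_insert)
    finally have "\<bar>a j\<bar> * \<bar>R\<bar> \<le> \<bar>a j\<bar> * (m * \<eta>)" by (intro mult_left_mono) auto
    then have R: "- (\<bar>a j\<bar> * (m * \<eta>)) \<le> a j * R"
      using abs_ge_minus_self[of "a j * R"] by (simp add: abs_mult)
    have sgn: "a j * (sgn (a j) * blinfun_apply (y j) (x j)) = \<bar>a j\<bar> * blinfun_apply (y j) (x j)"
      by (simp add: abs_sgn)
    have "\<bar>a j\<bar> * c \<le> \<bar>a j\<bar> * blinfun_apply (y j) (x j)"
      using diag[OF j] by (intro mult_left_mono) auto
    then show ?thesis
      using R unfolding S distrib_left left_diff_distrib sgn by (simp add: ac_simps)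
  qed
  then have "(\<Sum>j<m. (c - m * \<eta>) * \<bar>a j\<bar>) \<le> (\<Sum>j<m. a j * blinfun_apply (y j) ?S)"
    by (intro sum_mono) auto
  also have "\<dots> = blinfun_apply ?F ?S"
    by (simp add: blinfun.sum_left blinfun.scaleR_left)
  also have "\<dots> \<le> norm ?F * norm ?S"
    using norm_blinfun[of ?F ?S] by (simp add: abs_le_iff)
  also have "\<dots> \<le> norm ?F * K" using K by (intro mult_left_mono) auto
  finally show ?thesis by (simp add: sum_distrib_left mult.commute)
qed

text \<open>A functional of norm at most one that is at least \<open>\<epsilon>\<close> in modulus on \<open>l\<close> members of a plegma
  family of vectors with a uniform upper \<open>c\<^sub>0\<close>-estimate \<open>K\<close> forces \<open>l \<epsilon> \<le> K\<close>. So the homogeneous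
  set given by Ramsey's theorem has the small colour in both orders.\<close>

lemma plegma_pairs_null_refine:
  fixes x :: "nat list \<Rightarrow> 'a::real_normed_vector" and y :: "nat list \<Rightarrow> 'a \<Rightarrow>\<^sub>L real"
  assumes y: "\<And>s. norm (y s) \<le> 1"
    and ub: "\<And>l m ss a. \<lbrakk>m \<le> l; length ss = m; set ss \<subseteq> ksubsets (Z \<inter> {N l..}) k; plegma k ss;
       \<forall>j<m. \<bar>a j\<bar> \<le> 1\<rbrakk> \<Longrightarrow> norm (\<Sum>j<m. a j *\<^sub>R x (ss ! j)) \<le> K"
    and Y: "infinite Y" "Y \<subseteq> Z" and "0 < \<epsilon>"
  shows "\<exists>Y'\<subseteq>Y. infinite Y' \<and> (\<forall>s\<in>ksubsets Y' k. \<forall>t\<in>ksubsets Y' k. plegma k [s, t] \<longrightarrow>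
    \<bar>blinfun_apply (y s) (x t)\<bar> < \<epsilon> \<and> \<bar>blinfun_apply (y t) (x s)\<bar> < \<epsilon>)"
proof -
  define c where "c ss = (\<bar>blinfun_apply (y (ss ! 0)) (x (ss ! 1))\<bar> < \<epsilon>,
    \<bar>blinfun_apply (y (ss ! 1)) (x (ss ! 0))\<bar> < \<epsilon>)" for ss
  have fin: "finite (c ` {ss. length ss = 2})" by (rule finite_subset[OF subset_UNIV]) simp
  show ?thesis
  proof (rule plegma_Ramsey[OF Y(1) fin, where k = k], intro exI conjI ballI impI)
    fix Y'
    assume Y': "Y' \<subseteq> Y" "infinite Y'"
      and hom: "\<And>ss tt. \<lbrakk>length ss = 2; set ss \<subseteq> ksubsets Y' k; plegma k ss;
        length tt = 2; set tt \<subseteq> ksubsets Y' k; plegma k tt\<rbrakk> \<Longrightarrow> c ss = c tt"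
    fix s t assume st: "s \<in> ksubsets Y' k" "t \<in> ksubsets Y' k" "plegma k [s, t]"
    obtain l0 :: nat where "K / \<epsilon> < l0" using reals_Archimedean2 by blast
    then have l0: "K < l0 * \<epsilon>" using \<open>0 < \<epsilon>\<close> by (simp add: field_simps)
    \<comment> \<open>One more than l0, so that every member has l0 others and being large on all of
      them would give l0 * eps <= K.\<close>
    let ?l = "Suc l0"
    define d where "d = enumerate Y'"
    have d: "strict_mono d" "range d = Y'"
      using Y'(2) by (simp_all add: d_def strict_mono_enumerate range_enumerate)
    define ss where "ss = map (block d k ?l (N ?l)) [0..<?l]"
    have pl: "plegma k ss" unfolding ss_def by (rule plegma_blocks[OF d(1)]) simp
    have ssd: "set ss \<subseteq> ksubsets (d ` {N ?l..}) k"
      unfolding ss_def using block_in_ksubsets[OF d(1), of ?l k "N ?l"] by auto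
    have "d ` {N ?l..} \<subseteq> Z \<inter> {N ?l..}"
    proof
      fix z assume "z \<in> d ` {N ?l..}"
      then obtain i where "N ?l \<le> i" "z = d i" by auto
      moreover have "i \<le> d i" by (rule seq_suble[OF d(1)])
      ultimately show "z \<in> Z \<inter> {N ?l..}" using d(2) Y' Y by auto
    qed
    then have ssZ: "set ss \<subseteq> ksubsets (Z \<inter> {N ?l..}) k"
      using ssd ksubsets_mono by blast
    have ssY: "set ss \<subseteq> ksubsets Y' k"
      using ssd ksubsets_mono[of "d ` {N ?l..}" Y'] d(2) by blast
    have len: "length ss = ?l" by (simp add: ss_def)
    have exists_small: "\<exists>j<?l. j \<noteq> i \<and> \<bar>blinfun_apply (y (ss ! i)) (x (ss ! j))\<bar> < \<epsilon>" if "i < ?l" for i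
    proof (rule ccontr)
      let ?f = "\<lambda>j. blinfun_apply (y (ss ! i)) (x (ss ! j))"
      assume "\<not> ?thesis"
      then have big: "\<epsilon> \<le> \<bar>?f j\<bar>" if "j < ?l" "j \<noteq> i" for j
        using that by (meson not_less)
      define a where "a j = (if j = i then 0 else sgn (?f j))" for j
      let ?S = "\<Sum>j<?l. a j *\<^sub>R x (ss ! j)"
      have a1: "\<forall>j<?l. \<bar>a j\<bar> \<le> 1" by (auto simp: a_def sgn_if)
      have "l0 * \<epsilon> = (\<Sum>j\<in>{..<?l} - {i}. \<epsilon>)" using that by simp
      also have "\<dots> \<le> (\<Sum>j\<in>{..<?l} - {i}. a j * ?f j)"
      proof (rule sum_mono)
        fix j assume j: "j \<in> {..<?l} - {i}"
        then have "a j * ?f j = \<bar>?f j\<bar>" by (simp add: a_def abs_sgn mult.commute)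
        then show "\<epsilon> \<le> a j * ?f j" using big[of j] j by simp
      qed
      also have "\<dots> = (\<Sum>j<?l. a j * ?f j)"
        by (rule sum.mono_neutral_left) (auto simp: a_def)
      also have "\<dots> = blinfun_apply (y (ss ! i)) ?S"
        by (simp add: blinfun.sum_right blinfun.scaleR_right del: sum.lessThan_Suc)
      also have "\<dots> \<le> norm (y (ss ! i)) * norm ?S"
        using norm_blinfun[of "y (ss ! i)" ?S] by (simp add: abs_le_iff del: sum.lessThan_Suc)
      also have "\<dots> \<le> 1 * norm ?S"
        by (rule mult_right_mono[OF y norm_ge_zero])
      also have "\<dots> \<le> K"
        using ub[OF order_refl len ssZ pl a1] by simp
      finally show False using l0 by simp
    qed
    have pair: "c [s, t] = c [ss ! i, ss ! j]" if "i < j" "j < ?l" for i j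
      using that st pl ssY len plegma_pair[OF pl that(1)] nth_mem[of i ss] nth_mem[of j ss]
      by (intro hom) auto
    \<comment> \<open>The first member has only later partners, so its small value decides the first
      component of the colour; the last member has only earlier ones and decides the second.\<close>
    obtain j where j: "j < ?l" "j \<noteq> 0" "\<bar>blinfun_apply (y (ss ! 0)) (x (ss ! j))\<bar> < \<epsilon>"
      using exists_small[of 0] by auto
    with pair[of 0 j] show "\<bar>blinfun_apply (y s) (x t)\<bar> < \<epsilon>" by (simp add: c_def)
    obtain i where i: "i < ?l" "i \<noteq> l0" "\<bar>blinfun_apply (y (ss ! l0)) (x (ss ! i))\<bar> < \<epsilon>"
      using exists_small[of l0] by auto
    with pair[of i l0] show "\<bar>blinfun_apply (y t) (x s)\<bar> < \<epsilon>" by (simp add: c_def)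
  qed
qed

text \<open>Far out, the error of the model is below half the lower c_0 constant, which bounds
  single vectors from below. For the upper bound any bound D of the errors will do, whence K = C +
  D.\<close>

lemma generates_c0_bounds:
  assumes k: "1 \<le> k" and c0: "equiv_c0_basis e nrm" and gen: "generates_ksm k x e nrm"
  obtains Z N K c where "infinite Z" "0 < c" "0 < K"
    "\<And>s. s \<in> ksubsets Z k \<Longrightarrow> c \<le> norm (x s)"
    "\<And>l m ss a. \<lbrakk>m \<le> l; length ss = m; set ss \<subseteq> ksubsets (Z \<inter> {N l..}) k; plegma k ss;
       \<forall>j<m. \<bar>a j\<bar> \<le> 1\<rbrakk> \<Longrightarrow> norm (\<Sum>j<m. a j *\<^sub>R x (ss ! j)) \<le> K"
proof -
  obtain c C where c: "0 < c" "0 < C" and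
    lower: "\<And>m a. m \<ge> 1 \<Longrightarrow> c * Max ((\<lambda>j. \<bar>a j\<bar>) ` {..<m}) \<le> nrm (\<Sum>j<m. a j *\<^sub>R e j)" and
    upper: "\<And>m a. m \<ge> 1 \<Longrightarrow> nrm (\<Sum>j<m. a j *\<^sub>R e j) \<le> C * Max ((\<lambda>j. \<bar>a j\<bar>) ` {..<m})"
    using c0 unfolding equiv_c0_basis_def by blast
  obtain M \<delta> where M: "infinite M" and \<delta>: "\<And>l. 0 < \<delta> l" "\<delta> \<longlonglongrightarrow> 0" and
    raw: "\<forall>l\<ge>1. \<forall>m\<le>l. \<forall>ss a. length ss = m \<and> set ss \<subseteq> ksubsets M k \<and> plegma k ss \<and>
      (ss \<noteq> [] \<longrightarrow> hd ss ! 0 \<ge> enumerate M (l - 1)) \<and> (\<forall>j<m. \<bar>a j\<bar> \<le> 1) \<longrightarrow>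
      \<bar>norm (\<Sum>j<m. a j *\<^sub>R x (ss ! j)) - nrm (\<Sum>j<m. a j *\<^sub>R e j)\<bar> \<le> \<delta> l"
    using gen unfolding generates_ksm_def by (elim exE conjE) blast
  have "Bseq \<delta>" using \<delta>(2) by (intro convergent_imp_Bseq convergentI)
  then obtain D where D: "0 < D" "\<And>l. norm (\<delta> l) \<le> D" by (auto elim: BseqE)
  \<comment> \<open>The estimates of the model begin with l = 1; \<open>max 1 l\<close> also
    provides a threshold for l = 0.\<close>
  define N where "N l = enumerate M (max 1 l - 1)" for l
  have close': "\<bar>norm (\<Sum>j<m. a j *\<^sub>R x (ss ! j)) - nrm (\<Sum>j<m. a j *\<^sub>R e j)\<bar> \<le> \<delta> (max 1 l)"
    if "m \<le> max 1 l" "length ss = m" "set ss \<subseteq> ksubsets (M \<inter> {N l..}) k" "plegma k ss"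
      "\<forall>j<m. \<bar>a j\<bar> \<le> 1" for l m ss a
  proof (rule raw[rule_format], simp, rule that(1), intro conjI)
    show "set ss \<subseteq> ksubsets M k"
      using that(3) ksubsets_mono[of "M \<inter> {N l..}" M k] by blast
    show "ss \<noteq> [] \<longrightarrow> hd ss ! 0 \<ge> enumerate M (max 1 l - 1)"
    proof
      assume "ss \<noteq> []"
      then have "hd ss \<in> ksubsets (M \<inter> {N l..}) k" using that(3) by auto
      then have "length (hd ss) = k" "set (hd ss) \<subseteq> {N l..}" by (auto simp: ksubsets_def)
      then show "hd ss ! 0 \<ge> enumerate M (max 1 l - 1)"
        using k subsetD[OF _ nth_mem, of "hd ss" "{N l..}" 0] by (simp add: N_def)
    qed
  qed (use that in auto)
  have "eventually (\<lambda>l. \<delta> l < c / 2) sequentially"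
    using \<delta>(2) c(1) by (intro order_tendstoD) auto
  then obtain l0 where "\<And>l. l0 \<le> l \<Longrightarrow> \<delta> l < c / 2" by (auto simp: eventually_sequentially)
  then have l0: "\<delta> (max 1 l0) < c / 2" by simp
  show thesis
  proof (rule that[of "M \<inter> {N l0..}" "c / 2" "C + D" N])
    have "M \<subseteq> (M \<inter> {N l0..}) \<union> {..<N l0}" by auto
    then show "infinite (M \<inter> {N l0..})"
      using M by (meson finite_Un finite_lessThan finite_subset)
    show "0 < c / 2" "0 < C + D" using c D by auto
  next
    \<comment> \<open>A single k-set is a plegma family of length one, because its entries
      increase.\<close>
    fix s assume s: "s \<in> ksubsets (M \<inter> {N l0..}) k"
    have "\<bar>norm (\<Sum>j<1. 1 *\<^sub>R x ([s] ! j)) - nrm (\<Sum>j<1. 1 *\<^sub>R e j)\<bar> \<le> \<delta> (max 1 l0)"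
      using s by (intro close'[where a = "\<lambda>_. 1"])
        (auto simp: plegma_def ksubsets_def sorted_wrt_iff_nth_less)
    moreover have "c \<le> nrm (\<Sum>j<1. 1 *\<^sub>R e j)"
      using lower[of 1 "\<lambda>_. 1"] by (simp add: lessThan_Suc)
    ultimately show "c / 2 \<le> norm (x s)" using l0 by simp
  next
    fix l m ss and a :: "nat \<Rightarrow> real"
    assume ml: "m \<le> l" and len: "length ss = m"
      and sub: "set ss \<subseteq> ksubsets (M \<inter> {N l0..} \<inter> {N l..}) k"
      and pl: "plegma k ss" and a: "\<forall>j<m. \<bar>a j\<bar> \<le> 1"
    show "norm (\<Sum>j<m. a j *\<^sub>R x (ss ! j)) \<le> C + D"
    proof (cases "m = 0")
      case True
      then show ?thesis using c D by simp
    next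
      case False
      have "set ss \<subseteq> ksubsets (M \<inter> {N l..}) k"
        using sub ksubsets_mono[of "M \<inter> {N l0..} \<inter> {N l..}" "M \<inter> {N l..}" k] by blast
      then have "\<bar>norm (\<Sum>j<m. a j *\<^sub>R x (ss ! j)) - nrm (\<Sum>j<m. a j *\<^sub>R e j)\<bar> \<le> \<delta> (max 1 l)"
        using ml len pl a by (intro close') auto
      moreover have "Max ((\<lambda>j. \<bar>a j\<bar>) ` {..<m}) \<le> 1"
        using a False by (subst Max_le_iff) (auto simp: lessThan_empty_iff)
      then have "C * Max ((\<lambda>j. \<bar>a j\<bar>) ` {..<m}) \<le> C"
        using c(2) mult_left_le by fastforce
      then have "nrm (\<Sum>j<m. a j *\<^sub>R e j) \<le> C"
        using upper[of m a] False by linarith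
      moreover have "\<delta> (max 1 l) \<le> D" using D(2)[of "max 1 l"] by simp
      ultimately show ?thesis by linarith
    qed
  qed
qed

text \<open>In the block family with parameter N the pair bound is 1/(N+1). With m fixed, the factor
  c - m/(N+1) tends to c, so the limit seminorm has lower constant c/K.\<close>

lemma equiv_l1_limit_norm:
  fixes x :: "nat list \<Rightarrow> 'a::real_normed_vector" and y :: "nat list \<Rightarrow> 'a \<Rightarrow>\<^sub>L real"
  assumes d: "strict_mono d" "range d \<subseteq> Z" and "0 < c" "0 < K"
    and y: "\<And>s. norm (y s) \<le> 1" "\<And>s. blinfun_apply (y s) (x s) = norm (x s)"
    and x_lower: "\<And>s. s \<in> ksubsets Z k \<Longrightarrow> c \<le> norm (x s)"
    and x_upper: "\<And>l m ss a. \<lbrakk>m \<le> l; length ss = m; set ss \<subseteq> ksubsets (d ` {l..}) k; plegma k ss;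
       \<forall>j<m. \<bar>a j\<bar> \<le> 1\<rbrakk> \<Longrightarrow> norm (\<Sum>j<m. a j *\<^sub>R x (ss ! j)) \<le> K"
    and pairs: "\<And>l s t. \<lbrakk>s \<in> ksubsets (d ` {l..}) k; t \<in> ksubsets (d ` {l..}) k; plegma k [s, t]\<rbrakk> \<Longrightarrow>
       \<bar>blinfun_apply (y s) (x t)\<bar> < inverse (real (Suc l)) \<and> \<bar>blinfun_apply (y t) (x s)\<bar> < inverse (real (Suc l))"
    and conv: "\<And>p. (\<lambda>N. block_norm k y d N p) \<longlonglongrightarrow> limit_norm k y d p"
  shows "equiv_l1_basis (\<lambda>n. Poly_Mapping.single n 1) (limit_norm k y d)"
  unfolding equiv_l1_basis_def
proof (intro exI conjI allI)
  show "0 < c / K" using \<open>0 < c\<close> \<open>0 < K\<close> by simp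
  fix m and a :: "nat \<Rightarrow> real"
  let ?p = "\<Sum>j<m. a j *\<^sub>R Poly_Mapping.single j (1::real)"
  have block: "block_norm k y d N ?p = norm (\<Sum>j<m. a j *\<^sub>R y (block d k N N j))" if "m \<le> N" for N
    using that by (subst block_norm_finite_support[of m]) (auto simp: lookup_sum_scaleR_single)
  show "limit_norm k y d ?p \<le> 1 * (\<Sum>j<m. \<bar>a j\<bar>)"
    by (rule LIMSEQ_le_const2[OF conv])
      (use block norm_sum_scaleR_le[OF y(1)] in \<open>auto intro!: exI[of _ m]\<close>)
  have le: "(c - m * inverse (real (Suc N))) * (\<Sum>j<m. \<bar>a j\<bar>) \<le> K * block_norm k y d N ?p" if N: "m \<le> N" for N
  proof -
    define ss where "ss = map (block d k N N) [0..<m]"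
    have pl: "plegma k ss" unfolding ss_def by (rule plegma_blocks[OF d(1) N])
    have sub: "set ss \<subseteq> ksubsets (d ` {N..}) k"
      unfolding ss_def by (rule set_blocks_subset[OF d(1) order_refl N])
    have len: "length ss = m" by (simp add: ss_def)
    have ss_in: "ss ! j \<in> ksubsets (d ` {N..}) k" if "j < m" for j
      using sub nth_mem[of j ss] that len by blast
    have nth: "ss ! j = block d k N N j" if "j < m" for j
      using that by (simp add: ss_def)
    have "(c - m * inverse (real (Suc N))) * (\<Sum>j<m. \<bar>a j\<bar>) \<le> K * norm (\<Sum>j<m. a j *\<^sub>R y (ss ! j))"
    proof (rule l1_lower_bound[where x = "\<lambda>j. x (ss ! j)"])
      fix j assume "j < m"
      then have "ss ! j \<in> ksubsets Z k"
        using ss_in ksubsets_mono[of "d ` {N..}" Z k] d(2) by blast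
      then show "c \<le> blinfun_apply (y (ss ! j)) (x (ss ! j))" using x_lower y(2) by simp
    next
      fix i j assume "i < m" "j < m" "i \<noteq> j"
      then consider "i < j" | "j < i" by linarith
      then show "\<bar>blinfun_apply (y (ss ! j)) (x (ss ! i))\<bar> \<le> inverse (real (Suc N))"
      proof cases
        case 1
        then show ?thesis
          using pairs[OF ss_in ss_in plegma_pair[OF pl 1]] \<open>i < m\<close> \<open>j < m\<close> len by simp
      next
        case 2
        then show ?thesis
          using pairs[OF ss_in ss_in plegma_pair[OF pl 2]] \<open>i < m\<close> \<open>j < m\<close> len by simp
      qed
    next
      show "norm (\<Sum>i<m. sgn (a i) *\<^sub>R x (ss ! i)) \<le> K"
        by (rule x_upper[OF N len sub pl]) (simp add: sgn_if)
    qed simp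
    also have "(\<Sum>j<m. a j *\<^sub>R y (ss ! j)) = (\<Sum>j<m. a j *\<^sub>R y (block d k N N j))"
      by (rule sum.cong) (simp_all add: nth)
    finally show ?thesis by (simp add: block[OF N])
  qed
  have lim: "(\<lambda>N. (c - m * inverse (real (Suc N))) * (\<Sum>j<m. \<bar>a j\<bar>)) \<longlonglongrightarrow> (c - real m * 0) * (\<Sum>j<m. \<bar>a j\<bar>)"
    by (intro tendsto_intros LIMSEQ_inverse_real_of_nat)
  have "(c - real m * 0) * (\<Sum>j<m. \<bar>a j\<bar>) \<le> K * limit_norm k y d ?p"
    using le by (intro LIMSEQ_le[OF lim tendsto_mult_left[OF conv]]) blast
  then show "c / K * (\<Sum>j<m. \<bar>a j\<bar>) \<le> limit_norm k y d ?p"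
    using \<open>0 < K\<close> by (simp add: field_simps)
qed simp

theorem mainTheorem12:
  fixes k :: nat
    and x :: "nat list \<Rightarrow> 'a::banach"
    and e :: "nat \<Rightarrow> 'e::real_vector"
    and nrm :: "'e \<Rightarrow> real"
  assumes "k \<ge> 1"
    and "seminorm nrm" and "hamel_basis e"
    and "weakly_rel_compact_kseq k x"
    and "generates_ksm k x e nrm"
    and "equiv_c0_basis e nrm"
  shows "\<exists>(y :: nat list \<Rightarrow> ('a \<Rightarrow>\<^sub>L real)) (f :: nat \<Rightarrow> ((nat, real) poly_mapping)) (nrm' :: ((nat, real) poly_mapping) \<Rightarrow> real).
           seminorm nrm' \<and> hamel_basis f \<and> generates_ksm k y f nrm' \<and> equiv_l1_basis f nrm'"
proof (rule generates_c0_bounds[OF assms(1,6,5)])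
  fix Z N K c
  assume Z: "infinite Z" and cK: "0 < c" "0 < K"
    and x_lower: "\<And>s. s \<in> ksubsets Z k \<Longrightarrow> c \<le> norm (x s)"
    and x_upper: "\<And>l m ss a. \<lbrakk>m \<le> l; length ss = m; set ss \<subseteq> ksubsets (Z \<inter> {N l..}) k; plegma k ss;
       \<forall>j<m. \<bar>a j\<bar> \<le> 1\<rbrakk> \<Longrightarrow> norm (\<Sum>j<m. a j *\<^sub>R x (ss ! j)) \<le> K"
  have "\<exists>f :: 'a \<Rightarrow>\<^sub>L real. norm f \<le> 1 \<and> blinfun_apply f (x s) = norm (x s)" for s
    using norming_functional_exists[of "x s"] by blast
  then obtain y :: "nat list \<Rightarrow> 'a \<Rightarrow>\<^sub>L real"
    where y: "\<And>s. norm (y s) \<le> 1" "\<And>s. blinfun_apply (y s) (x s) = norm (x s)" by metis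
  define pairs where "pairs l Y \<longleftrightarrow> (\<forall>s\<in>ksubsets Y k. \<forall>t\<in>ksubsets Y k. plegma k [s, t] \<longrightarrow>
    \<bar>blinfun_apply (y s) (x t)\<bar> < inverse (real (Suc l)) \<and> \<bar>blinfun_apply (y t) (x s)\<bar> < inverse (real (Suc l)))"
    for l Y
  \<comment> \<open>Stability is asked up to length l + 1, to match the index shift in
    \<open>generates_limit_norm\<close>; the condition on \<open>N l\<close> puts families in the
    tail from l within reach of the upper c_0 estimate for lengths up to l.\<close>
  define Q where "Q l Y \<longleftrightarrow> (\<forall>m\<le>Suc l. plegma_stable k y m (1 / real (Suc l)) Y) \<and> pairs l Y \<and> Y \<subseteq> {N l..}"
    for l Y
  have pairs_subset: "pairs l Y'" if "pairs l Y" "Y' \<subseteq> Y" for l Y Y'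
    using that(1) ksubsets_mono[OF that(2), of k] unfolding pairs_def by blast
  have refine: "\<exists>Y'\<subseteq>Y. infinite Y' \<and> Q l Y'" if Y: "infinite Y" "Y \<subseteq> Z" for l Y
  proof -
    obtain Y1 where Y1: "Y1 \<subseteq> Y" "infinite Y1" "\<forall>m\<le>Suc l. plegma_stable k y m (1 / real (Suc l)) Y1"
    proof -
      have "\<exists>Y1\<subseteq>Y. infinite Y1 \<and> (\<forall>m\<le>Suc l. plegma_stable k y m (1 / real (Suc l)) Y1)"
        by (rule refine_finitely_many[OF Y(1)]) (auto intro: plegma_stable_refine y(1) plegma_stable_subset)
      then show thesis using that by blast
    qed
    have "Y1 \<subseteq> Z" using Y1 Y by blast
    have "\<exists>Y2\<subseteq>Y1. infinite Y2 \<and> pairs l Y2"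
      unfolding pairs_def
    proof (rule plegma_pairs_null_refine[where Z = Z and N = N and K = K])
      show "norm (\<Sum>j<m. a j *\<^sub>R x (ss ! j)) \<le> K"
        if "m \<le> l" "length ss = m" "set ss \<subseteq> ksubsets (Z \<inter> {N l..}) k" "plegma k ss" "\<forall>j<m. \<bar>a j\<bar> \<le> 1"
        for l m ss a
        using that by (rule x_upper)
      show "norm (y s) \<le> 1" for s by (rule y(1))
      show "infinite Y1" "Y1 \<subseteq> Z" by fact+
      show "0 < inverse (real (Suc l))" by simp
    qed
    then obtain Y2 where Y2: "Y2 \<subseteq> Y1" "infinite Y2" "pairs l Y2" by blast
    \<comment> \<open>Discarding the points below \<open>N l\<close> removes only finitely
      many.\<close>
    have "Y2 \<subseteq> (Y2 \<inter> {N l..}) \<union> {..<N l}" by auto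
    then have "infinite (Y2 \<inter> {N l..})"
      using Y2(2) by (meson finite_Un finite_lessThan finite_subset)
    moreover have "Q l (Y2 \<inter> {N l..})"
      unfolding Q_def
    proof (intro conjI allI impI)
      fix m assume "m \<le> Suc l"
      then show "plegma_stable k y m (1 / real (Suc l)) (Y2 \<inter> {N l..})"
        using Y1(3) Y2(1) by (blast intro: plegma_stable_subset[of k y m _ Y1])
    next
      show "pairs l (Y2 \<inter> {N l..})" by (rule pairs_subset[OF Y2(3)]) simp
    qed simp
    ultimately show ?thesis using Y1(1) Y2(1) by (intro exI[of _ "Y2 \<inter> {N l..}"]) auto
  qed
  have hered: "Q l Y'" if "Q l Y" "Y' \<subseteq> Y" for l Y Y'
    using that plegma_stable_subset[of k y _ _ Y Y'] pairs_subset[of l Y Y'] unfolding Q_def by blast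
  have "\<exists>d :: nat \<Rightarrow> nat. strict_mono d \<and> range d \<subseteq> Z \<and> (\<forall>l. Q l (d ` {l..}))"
    by (rule diagonal_infinite_subset[where Q = Q, OF Z], erule (1) refine, erule (1) hered) blast
  then obtain d where d: "strict_mono d" "range d \<subseteq> Z" and Qd: "\<And>l. Q l (d ` {l..})" by blast
  have stable: "plegma_stable k y m (1 / real (Suc l)) (d ` {l..})" if "m \<le> Suc l" for l m
    using Qd that unfolding Q_def by blast
  have sub: "ksubsets (d ` {l..}) k \<subseteq> ksubsets (Z \<inter> {N l..}) k" for l
    using d(2) Qd[of l] unfolding Q_def by (intro ksubsets_mono) auto
  note conv = block_norm_convergent[OF d(1) stable]
  have "equiv_l1_basis (\<lambda>n. Poly_Mapping.single n 1) (limit_norm k y d)"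
  proof (rule equiv_l1_limit_norm[OF d cK y x_lower _ _ conv])
    show "norm (\<Sum>j<m. a j *\<^sub>R x (ss ! j)) \<le> K"
      if "m \<le> l" "length ss = m" "set ss \<subseteq> ksubsets (d ` {l..}) k" "plegma k ss" "\<forall>j<m. \<bar>a j\<bar> \<le> 1"
      for l m ss a
      using that sub[of l] by (intro x_upper[of m l]) auto
    show "\<bar>blinfun_apply (y s) (x t)\<bar> < inverse (real (Suc l)) \<and> \<bar>blinfun_apply (y t) (x s)\<bar> < inverse (real (Suc l))"
      if "s \<in> ksubsets (d ` {l..}) k" "t \<in> ksubsets (d ` {l..}) k" "plegma k [s, t]" for l s t
      using Qd[of l] that unfolding Q_def pairs_def by blast
  qed
  then show ?thesis
    using seminorm_limit_norm[OF conv] hamel_basis_single generates_limit_norm[OF assms(1) d(1) stable]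
    by (intro exI conjI)
qed

end
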